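(* Let $G=(V,A)$ be a directed multigraph, let $A_1,A_2$ be an arbitrary arc split of $G$, and let $s,t\in V$. Then every set $M\subseteq A$ that is split-covering with respect to $A_1,A_2$ and $s,t$ is an $s$-$t$ cut in $G$. Moreover, there exists an $s$-$t$ min-cut in $G$ that is split-covering with respect to $A_1,A_2$ and $s,t$.
   Context: Arcs have unit capacities; parallel arcs are allowed and each arc has its own identity. For vertices $x,y$ and a subgraph $H$, a set $M$ of arcs is an $x$-$y$ cut in $H$ if $y$ is not reachable from $x$ in $H\setminus M$; a min-cut is a cut of minimum cardinality. Source side $S_M$: vertices reachable from $x$ in $H\setminus M$; target side $T_M$: vertices from which $y$ is reachable in $H\setminus M$. $M$ is strictly later than $M'$ ($M>M'$) iff $T_M\subsetneq T_{M'}$, and strictly earlier ($M<M'$) iff $S_M\subsetneq S_{M'}$. An $x$-$y$ cut $M$ is $x$-$y$-latest (resp. $x$-$y$-earliest) in $H$ iff there is no $x$-$y$ cut $M''$ in $H$ with $M''>M$ (resp. $M''<M$) and $|M''|\le|M|$. An arc split of $G=(V,A)$ is a partition $A=A_1\cup A_2$ such that there are no vertices $x,y,z$ with $(x,y)\in A_2$ and $(y,z)\in A_1$. A set $M\subseteq A$ is split-covering with respect to $A_1,A_2$ and $s,t$ iff for every $v\in V$ there exists $M_v\subseteq M$ such that at least one of the following holds: (i) $s\ne v\ne t$ and $v$ is either unreachable from $s$ in $(V,A_1)$ or $v$ does not reach $t$ in $(V,A_2)$; (ii) $M_v$ is an $s$-$v$-earliest cut in $(V,A_1)$; (iii) $M_v$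 is a $v$-$t$-latest cut in $(V,A_2)$.
   Formalization: The existence of a split-covering s-t min-cut is stated only for s ≠ t: when s = t no s-t cut exists at all, since s always reaches itself. The graph is finite, as usual. *)

theory Defs
  imports Main "Graph_Theory.Digraph"
begin

definition with_arcs :: "('a,'b) pre_digraph \<Rightarrow> 'b set \<Rightarrow> ('a,'b) pre_digraph" where
  "with_arcs G B = G\<lparr>arcs := B\<rparr>"

definition del_arcs :: "('a,'b) pre_digraph \<Rightarrow> 'b set \<Rightarrow> ('a,'b) pre_digraph" where
  "del_arcs H M = with_arcs H (arcs H - M)"

definition is_cut :: "('a,'b) pre_digraph \<Rightarrow> 'a \<Rightarrow> 'a \<Rightarrow> 'b set \<Rightarrow> bool" where
  "is_cut H x y M \<longleftrightarrow> M \<subseteq> arcs H \<and> \<not> x \<rightarrow>\<^sup>*\<^bsub>del_arcs H M\<^esub> y"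

definition is_min_cut :: "('a,'b) pre_digraph \<Rightarrow> 'a \<Rightarrow> 'a \<Rightarrow> 'b set \<Rightarrow> bool" where
  "is_min_cut H x y M \<longleftrightarrow> is_cut H x y M \<and> (\<forall>M'. is_cut H x y M' \<longrightarrow> card M \<le> card M')"

definition source_side :: "('a,'b) pre_digraph \<Rightarrow> 'a \<Rightarrow> 'b set \<Rightarrow> 'a set" where
  "source_side H x M = {v \<in> verts H. x \<rightarrow>\<^sup>*\<^bsub>del_arcs H M\<^esub> v}"

definition target_side :: "('a,'b) pre_digraph \<Rightarrow> 'a \<Rightarrow> 'b set \<Rightarrow> 'a set" where
  "target_side H y M = {v \<in> verts H. v \<rightarrow>\<^sup>*\<^bsub>del_arcs H M\<^esub> y}"

definition strictly_earlier :: "('a,'b) pre_digraph \<Rightarrow> 'a \<Rightarrow> 'b set \<Rightarrow> 'b set \<Rightarrow> bool" where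
  "strictly_earlier H x M M' \<longleftrightarrow> source_side H x M \<subset> source_side H x M'"

definition strictly_later :: "('a,'b) pre_digraph \<Rightarrow> 'a \<Rightarrow> 'b set \<Rightarrow> 'b set \<Rightarrow> bool" where
  "strictly_later H y M M' \<longleftrightarrow> target_side H y M \<subset> target_side H y M'"

definition earliest_cut :: "('a,'b) pre_digraph \<Rightarrow> 'a \<Rightarrow> 'a \<Rightarrow> 'b set \<Rightarrow> bool" where
  "earliest_cut H x y M \<longleftrightarrow> is_cut H x y M \<and>
     \<not> (\<exists>M''. is_cut H x y M'' \<and> strictly_earlier H x M'' M \<and> card M'' \<le> card M)"

definition latest_cut :: "('a,'b) pre_digraph \<Rightarrow> 'a \<Rightarrow> 'a \<Rightarrow> 'b set \<Rightarrow> bool" where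
  "latest_cut H x y M \<longleftrightarrow> is_cut H x y M \<and>
     \<not> (\<exists>M''. is_cut H x y M'' \<and> strictly_later H y M'' M \<and> card M'' \<le> card M)"

text \<open>Either part of an arc split may be empty.\<close>

definition arc_split :: "('a,'b) pre_digraph \<Rightarrow> 'b set \<Rightarrow> 'b set \<Rightarrow> bool" where
  "arc_split G A1 A2 \<longleftrightarrow> arcs G = A1 \<union> A2 \<and> A1 \<inter> A2 = {} \<and>
     \<not> (\<exists>x y z. x \<rightarrow>\<^bsub>with_arcs G A2\<^esub> y \<and> y \<rightarrow>\<^bsub>with_arcs G A1\<^esub> z)"

definition split_covering ::
  "('a,'b) pre_digraph \<Rightarrow> 'b set \<Rightarrow> 'b set \<Rightarrow> 'a \<Rightarrow> 'a \<Rightarrow> 'b set \<Rightarrow> bool" where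
  "split_covering G A1 A2 s t M \<longleftrightarrow> M \<subseteq> arcs G \<and>
     (\<forall>v \<in> verts G. \<exists>Mv \<subseteq> M.
        (s \<noteq> v \<and> v \<noteq> t \<and>
          (\<not> s \<rightarrow>\<^sup>*\<^bsub>with_arcs G A1\<^esub> v \<or> \<not> v \<rightarrow>\<^sup>*\<^bsub>with_arcs G A2\<^esub> t)) \<or>
        earliest_cut (with_arcs G A1) s v Mv \<or>
        latest_cut (with_arcs G A2) v t Mv)"

end

theory Submission
  imports Defs
begin

text \<open>
  Every path follows arcs of A1 and then arcs of A2, so an arc set M is a cut iff no vertex is
  both reachable from s in A1 - M and able to reach t in A2 - M. Among the minimum cuts choose one
  for which these two vertex sets have the least total size. If v is separated from s by M in A1,
  let N be an inclusion-minimal subset of M doing so. Were N not earliest, witnessed by N', then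
  exchanging N for N' in M would give a minimum cut whose reachable sets are no larger, hence
  equal. But a minimum cut is the boundary of its reachable sets, so the exchange would not have
  changed M. The A2 side is the same argument with all arcs reversed.
\<close>

text \<open>The two end maps are parameters, so that swapping them reverses every arc. Facts proved
  once about vertices reachable from a source then also serve for vertices that reach a
  target.\<close>

definition reach_set :: "('b \<Rightarrow> 'a) \<Rightarrow> ('b \<Rightarrow> 'a) \<Rightarrow> 'b set \<Rightarrow> 'a \<Rightarrow> 'a set" where
  "reach_set src dst B x = {v. (x, v) \<in> ((\<lambda>e. (src e, dst e)) ` B)\<^sup>*}"

lemma reach_set_refl [simp]: "x \<in> reach_set src dst B x"
  by (simp add: reach_set_def)

lemma reach_set_step:
  "e \<in> B \<Longrightarrow> src e \<in> reach_set src dst B x \<Longrightarrow> dst e \<in> reach_set src dst B x"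
  unfolding reach_set_def by (auto intro: rtrancl_into_rtrancl)

lemma reach_set_induct [consumes 1, case_names refl step]:
  assumes "v \<in> reach_set src dst B x" and "P x"
    and "\<And>e. e \<in> B \<Longrightarrow> src e \<in> reach_set src dst B x \<Longrightarrow> P (src e) \<Longrightarrow> P (dst e)"
  shows "P v"
proof -
  have "(x, v) \<in> ((\<lambda>e. (src e, dst e)) ` B)\<^sup>*"
    using assms(1) by (simp add: reach_set_def)
  then show ?thesis
    by (induction rule: rtrancl_induct) (use assms(2,3) in \<open>auto simp: reach_set_def\<close>)
qed

lemma reach_set_subsetI:
  assumes "x \<in> S" and "\<And>e. e \<in> B \<Longrightarrow> src e \<in> S \<Longrightarrow> dst e \<in> S"
  shows "reach_set src dst B x \<subseteq> S"
proof
  fix v assume "v \<in> reach_set src dst B x"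
  then show "v \<in> S" by (induction rule: reach_set_induct) (use assms in auto)
qed

lemma reach_set_mono: "B \<subseteq> C \<Longrightarrow> reach_set src dst B x \<subseteq> reach_set src dst C x"
  by (intro reach_set_subsetI) (auto intro: reach_set_step)

lemma finite_reach_set: "finite B \<Longrightarrow> finite (reach_set src dst B x)"
  by (rule finite_subset[of _ "insert x (dst ` B)"], rule reach_set_subsetI) auto

lemma reach_set_flip: "y \<in> reach_set src dst B x \<longleftrightarrow> x \<in> reach_set dst src B y"
proof -
  have "(\<lambda>e. (dst e, src e)) ` B = ((\<lambda>e. (src e, dst e)) ` B)\<inverse>" by auto
  then show ?thesis by (simp add: reach_set_def rtrancl_converse)
qed

text \<open>Restoring an arc whose head is already reachable makes nothing new reachable. So if
  restoring \<open>e\<close> reconnects \<open>v\<close>, the head of \<open>e\<close> was out of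
  reach.\<close>

lemma minimal_separator_crosses:
  assumes "v \<notin> reach_set src dst (B - N) x"
    and "e \<in> N" and "v \<in> reach_set src dst (B - (N - {e})) x"
  shows "dst e \<notin> reach_set src dst (B - N) x"
proof
  assume "dst e \<in> reach_set src dst (B - N) x"
  then have "reach_set src dst (B - (N - {e})) x \<subseteq> reach_set src dst (B - N) x"
    by (intro reach_set_subsetI) (auto intro: reach_set_step)
  then show False using assms by blast
qed

text \<open>A walk avoiding \<open>N'\<close> stays within the vertices reachable without
  \<open>N\<close>, and no arc of \<open>N\<close> ends there. So a walk that avoids
  \<open>(P - N) \<union> N'\<close> uses no arc of \<open>N\<close> either and avoids all of
  \<open>P\<close>.\<close>

lemma exchange_separator:
  assumes cross: "\<And>e. e \<in> N \<Longrightarrow> dst e \<notin> reach_set src dst (B - N) x"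
    and earlier: "reach_set src dst (B - N') x \<subseteq> reach_set src dst (B - N) x"
  shows "reach_set src dst (B - ((P - N) \<union> N')) x \<subseteq> reach_set src dst (B - P) x"
proof
  fix u assume "u \<in> reach_set src dst (B - ((P - N) \<union> N')) x"
  then show "u \<in> reach_set src dst (B - P) x"
  proof (induction rule: reach_set_induct)
    case (step e)
    have "dst e \<in> reach_set src dst (B - ((P - N) \<union> N')) x"
      using step by (intro reach_set_step)
    also have "\<dots> \<subseteq> reach_set src dst (B - N') x" by (rule reach_set_mono) auto
    finally have "e \<notin> N" using cross earlier by blast
    then show ?case using step by (intro reach_set_step) auto
  qed simp
qed

text \<open>\<open>Z\<close> stands for the side of the cut that is held fixed. The competitor
  \<open>N'\<close> is not asked to separate \<open>v\<close>: a smaller reachable set excludes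
  \<open>v\<close> anyway.\<close>

lemma earliest_separator_within:
  assumes fin: "finite B" and PB: "P \<subseteq> B" and PZ: "reach_set src dst (B - P) x \<inter> Z = {}"
    and least: "\<And>P'. P' \<subseteq> B \<Longrightarrow> reach_set src dst (B - P') x \<inter> Z = {} \<Longrightarrow> card P \<le> card P'"
    and tie: "\<And>P'. P' \<subseteq> B \<Longrightarrow> reach_set src dst (B - P') x \<inter> Z = {} \<Longrightarrow> card P' = card P \<Longrightarrow>
      \<not> reach_set src dst (B - P') x \<subset> reach_set src dst (B - P) x"
    and v: "v \<notin> reach_set src dst (B - P) x"
  shows "\<exists>N\<subseteq>P. v \<notin> reach_set src dst (B - N) x \<and>
    (\<forall>N'\<subseteq>B. reach_set src dst (B - N') x \<subset> reach_set src dst (B - N) x \<longrightarrow> card N < card N')"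
proof -
  let ?R = "\<lambda>X. reach_set src dst (B - X) x"
  have finP: "finite P" using fin PB by (rule rev_finite_subset)
  define bd where "bd = (\<lambda>S. {e \<in> B. src e \<in> S \<and> dst e \<notin> S})"
  \<comment> \<open>The boundary of the reachable set is contained in \<open>P'\<close> and confines
    reachability just as well, so \<open>least\<close> leaves no room for further arcs in
    \<open>P'\<close>.\<close>
  have boundary: "P' = bd (?R P')"
    if P': "P' \<subseteq> B" "?R P' \<inter> Z = {}" "card P' \<le> card P" for P'
  proof -
    have sub: "bd (?R P') \<subseteq> P'" by (auto simp: bd_def intro: reach_set_step)
    have "?R (bd (?R P')) \<subseteq> ?R P'"
      by (intro reach_set_subsetI) (auto simp: bd_def)
    then have "card P \<le> card (bd (?R P'))"
      using P' sub by (intro least) auto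
    then show ?thesis
      using P' sub fin by (metis card_seteq finite_subset le_trans)
  qed
  have "finite {N. N \<subseteq> P \<and> v \<notin> ?R N}" "P \<in> {N. N \<subseteq> P \<and> v \<notin> ?R N}"
    using finP v by auto
  then obtain N where N: "N \<subseteq> P" "v \<notin> ?R N"
    and min: "\<And>N'. N' \<subseteq> P \<Longrightarrow> v \<notin> ?R N' \<Longrightarrow> N' \<subseteq> N \<Longrightarrow> N = N'"
    using finite_has_minimal2[of "{N. N \<subseteq> P \<and> v \<notin> ?R N}" P] by auto
  have cross: "dst e \<notin> ?R N" if "e \<in> N" for e
    using min[of "N - {e}"] N that by (intro minimal_separator_crosses[of v]) auto
  have "card N < card N'" if N': "N' \<subseteq> B" "?R N' \<subset> ?R N" for N'
  proof (rule ccontr)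
    assume "\<not> card N < card N'"
    then have le: "card N' \<le> card N" by simp
    define P' where "P' = (P - N) \<union> N'"
    have sub: "?R P' \<subseteq> ?R P"
      unfolding P'_def using cross N'(2) by (intro exchange_separator) auto
    have "card P' \<le> card (P - N) + card N'"
      unfolding P'_def by (rule card_Un_le)
    also have "\<dots> \<le> card (P - N) + card N" using le by simp
    also have "\<dots> = card P"
      using card_Diff_subset[of N P] card_mono[OF finP N(1)] N(1) finP
      by (simp add: finite_subset)
    finally have card: "card P' \<le> card P" .
    have P': "P' \<subseteq> B" "?R P' \<inter> Z = {}" using PB N' sub PZ by (auto simp: P'_def)
    \<comment> \<open>\<open>P'\<close> is again minimum, so \<open>tie\<close> forbids a proper
      inclusion. Both sets are then the boundary of one and the same vertex set.\<close>
    have "?R P' = ?R P" using tie[OF P'] least[OF P'] card sub by auto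
    then have "P' = P" using boundary[OF P' card] boundary[OF PB PZ] by simp
    \<comment> \<open>The arcs of \<open>N\<close> were removed from \<open>P\<close> and can only
      have come back through \<open>N'\<close>. With \<open>card N' \<le> card N\<close> this gives
      \<open>N = N'\<close>, against the strict inclusion of the reachable sets.\<close>
    then have "N \<subseteq> N'" using N(1) by (auto simp: P'_def)
    then have "N = N'" using le N'(1) fin by (meson card_seteq finite_subset)
    then show False using N'(2) by simp
  qed
  then show ?thesis using N by blast
qed

text \<open>Library reachability keeps walks inside \<open>verts G\<close>. Well-formedness and the
  choice of \<open>x\<close> guarantee this for every walk along arcs of \<open>B\<close>.\<close>

lemma (in wf_digraph) reachable_with_arcs_iff:
  assumes "B \<subseteq> arcs G" and "x \<in> verts G"
  shows "x \<rightarrow>\<^sup>*\<^bsub>with_arcs G B\<^esub> y \<longleftrightarrow> y \<in> reach_set (tail G) (head G) B x"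
proof
  let ?H = "with_arcs G B"
  have ends: "arcs_ends ?H = (\<lambda>e. (tail G e, head G e)) ` B"
    by (simp add: with_arcs_def arcs_ends_def arc_to_ends_def)
  have verts: "verts ?H = verts G" by (simp add: with_arcs_def)
  show "y \<in> reach_set (tail G) (head G) B x" if "x \<rightarrow>\<^sup>*\<^bsub>?H\<^esub> y"
    using that unfolding reachable_def ends reach_set_def
    by (auto dest: rtrancl_on_rtranclI)
  show "x \<rightarrow>\<^sup>*\<^bsub>?H\<^esub> y" if "y \<in> reach_set (tail G) (head G) B x"
    using that
  proof (induction rule: reach_set_induct)
    case refl
    show ?case using assms(2) by (simp add: reachable_def verts)
  next
    case (step e)
    then have "tail G e \<rightarrow>\<^bsub>?H\<^esub> head G e" "head G e \<in> verts ?H"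
      using assms(1) by (auto simp: ends verts)
    with step.IH show ?case
      unfolding reachable_def by (blast intro: rtrancl_on_into_rtrancl_on)
  qed
qed

theorem theorem17:
  fixes G :: "('a, 'b) pre_digraph" and A1 A2 :: "'b set" and s t :: 'a
  assumes "fin_digraph G"
    and "arc_split G A1 A2"
    and "s \<in> verts G" and "t \<in> verts G"
  shows "(\<forall>M. split_covering G A1 A2 s t M \<longrightarrow> is_cut G s t M) \<and>
    (s \<noteq> t \<longrightarrow> (\<exists>M. is_min_cut G s t M \<and> split_covering G A1 A2 s t M))"
proof -
  interpret fin_digraph G by fact
  let ?R = "\<lambda>B. reach_set (tail G) (head G) B s"
  let ?T = "\<lambda>B. reach_set (head G) (tail G) B t"
  have A: "arcs G = A1 \<union> A2" "A1 \<inter> A2 = {}" "A1 \<subseteq> arcs G" "A2 \<subseteq> arcs G"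
    using assms(2) by (auto simp: arc_split_def)
  have fin: "finite A1" "finite A2" using A(3,4) by (auto intro: finite_subset)
  have split: "head G e \<noteq> tail G f" if "e \<in> A2" "f \<in> A1" for e f
    using that assms(2)
    by (force simp: arc_split_def with_arcs_def arcs_ends_def arc_to_ends_def)
  have del: "del_arcs (with_arcs G B) M = with_arcs G (B - M)" "del_arcs G M = with_arcs G (arcs G - M)"
    for B M by (simp_all add: del_arcs_def with_arcs_def)
  have arcs_with: "arcs (with_arcs G B) = B" "verts (with_arcs G B) = verts G" for B
    by (simp_all add: with_arcs_def)
  have reach_s: "s \<rightarrow>\<^sup>*\<^bsub>with_arcs G B\<^esub> v \<longleftrightarrow> v \<in> ?R B" if "B \<subseteq> arcs G" for B v
    using that assms(3) by (rule reachable_with_arcs_iff)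
  have reach_t: "v \<rightarrow>\<^sup>*\<^bsub>with_arcs G B\<^esub> t \<longleftrightarrow> v \<in> ?T B" if "B \<subseteq> arcs G" "v \<in> verts G" for B v
    using reachable_with_arcs_iff[OF that] by (simp add: reach_set_flip[of t])
  have R_verts: "?R B \<subseteq> verts G" and T_verts: "?T B \<subseteq> verts G" if "B \<subseteq> arcs G" for B
    by (rule reach_set_subsetI; use that assms(3,4) in auto)+

  have factor: "t \<in> ?R (arcs G - M) \<longleftrightarrow> ?R (A1 - M) \<inter> ?T (A2 - M) \<noteq> {}" for M
  proof
    \<comment> \<open>\<open>u\<close> is where the walk leaves its \<open>A1\<close> phase. The
      last disjunct records that \<open>w\<close> is still \<open>u\<close> or is the head of an
      \<open>A2\<close> arc; in the latter case the arc split rules out a following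
      \<open>A1\<close> arc, so the invariant survives each step.\<close>
    let ?S = "{w. \<exists>u \<in> ?R (A1 - M). w \<in> reach_set (tail G) (head G) (A2 - M) u \<and>
        (w = u \<or> w \<in> head G ` A2)}"
    have "?R (arcs G - M) \<subseteq> ?S"
    proof (rule reach_set_subsetI)
      show "s \<in> ?S" by (auto intro: bexI[of _ s])
    next
      fix e assume e: "e \<in> arcs G - M" "tail G e \<in> ?S"
      then obtain u where u: "u \<in> ?R (A1 - M)" "tail G e \<in> reach_set (tail G) (head G) (A2 - M) u"
        "tail G e = u \<or> tail G e \<in> head G ` A2" by blast
      show "head G e \<in> ?S"
      proof (cases "e \<in> A1")
        case True
        then have "tail G e = u" using u(3) split[of _ e] by force
        then have "head G e \<in> ?R (A1 - M)"
          using u(1) True e(1) by (intro reach_set_step) auto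
        then show ?thesis by (auto intro: bexI[of _ "head G e"])
      next
        case False
        then have "e \<in> A2 - M" using e(1) A(1) by auto
        then show ?thesis using u(1,2) by (auto intro: reach_set_step)
      qed
    qed
    moreover assume "t \<in> ?R (arcs G - M)"
    ultimately show "?R (A1 - M) \<inter> ?T (A2 - M) \<noteq> {}"
      using reach_set_flip[of t "tail G" "head G" "A2 - M"] by fastforce
  next
    assume "?R (A1 - M) \<inter> ?T (A2 - M) \<noteq> {}"
    then obtain u where u: "u \<in> ?R (A1 - M)" "t \<in> reach_set (tail G) (head G) (A2 - M) u"
      using reach_set_flip[of t "tail G" "head G" "A2 - M"] by auto
    have "u \<in> ?R (arcs G - M)"
      by (rule reach_set_mono[THEN subsetD, OF _ u(1)]) (use A(3) in auto)
    with u(2) show "t \<in> ?R (arcs G - M)"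
      by (induction rule: reach_set_induct) (use A(4) in \<open>auto intro: reach_set_step\<close>)
  qed
  have cut_iff: "is_cut G s t M \<longleftrightarrow> M \<subseteq> arcs G \<and> ?R (A1 - M) \<inter> ?T (A2 - M) = {}" for M
    unfolding is_cut_def del using reach_s[of "arcs G - M" t] factor by auto
  have cut1_iff: "is_cut (with_arcs G A1) s v M \<longleftrightarrow> M \<subseteq> A1 \<and> v \<notin> ?R (A1 - M)" for v M
    unfolding is_cut_def del arcs_with using reach_s[of "A1 - M" v] A(3) by auto
  have cut2_iff: "is_cut (with_arcs G A2) v t M \<longleftrightarrow> M \<subseteq> A2 \<and> v \<notin> ?T (A2 - M)"
    if "v \<in> verts G" for v M
    unfolding is_cut_def del arcs_with using reach_t[of "A2 - M" v] A(4) that by auto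
  have side1: "source_side (with_arcs G A1) s M = ?R (A1 - M)" for M
    unfolding source_side_def del arcs_with
    using reach_s[of "A1 - M"] R_verts[of "A1 - M"] A(3) by auto
  have side2: "target_side (with_arcs G A2) t M = ?T (A2 - M)" for M
    unfolding target_side_def del arcs_with
    using reach_t[of "A2 - M"] T_verts[of "A2 - M"] A(4) by auto

  have cut: "is_cut G s t M" if M: "split_covering G A1 A2 s t M" for M
  proof -
    \<comment> \<open>A vertex on both sides would refute every alternative of the covering
      condition: deleting only \<open>Mv\<close>, or nothing, preserves both reachabilities.\<close>
    have "v \<notin> ?T (A2 - M)" if v: "v \<in> ?R (A1 - M)" for v
    proof
      assume vT: "v \<in> ?T (A2 - M)"
      have V: "v \<in> verts G" using v R_verts[of "A1 - M"] A(3) by auto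
      obtain Mv where Mv: "Mv \<subseteq> M"
        "(\<not> s \<rightarrow>\<^sup>*\<^bsub>with_arcs G A1\<^esub> v \<or> \<not> v \<rightarrow>\<^sup>*\<^bsub>with_arcs G A2\<^esub> t) \<or>
          earliest_cut (with_arcs G A1) s v Mv \<or> latest_cut (with_arcs G A2) v t Mv"
        using M V unfolding split_covering_def by blast
      have "v \<in> ?R (A1 - Mv)" "v \<in> ?R A1"
        by (rule reach_set_mono[THEN subsetD, OF _ v]; use Mv(1) in auto)+
      moreover have "v \<in> ?T (A2 - Mv)" "v \<in> ?T A2"
        by (rule reach_set_mono[THEN subsetD, OF _ vT]; use Mv(1) in auto)+
      ultimately show False
        using Mv(2) V A(3,4)
        by (auto simp: reach_s reach_t earliest_cut_def latest_cut_def cut1_iff cut2_iff)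
    qed
    then show ?thesis using M by (auto simp: cut_iff split_covering_def)
  qed

  have "\<exists>M. is_min_cut G s t M \<and> split_covering G A1 A2 s t M" if "s \<noteq> t"
  proof -
    \<comment> \<open>Minimising the sum handles both sides at once: with one summand fixed, the
      choice is also minimal in the other.\<close>
    let ?size = "\<lambda>M. card (?R (A1 - M)) + card (?T (A2 - M))"
    \<comment> \<open>Once every arc is deleted only \<open>s\<close> is reachable from
      \<open>s\<close> and only \<open>t\<close> reaches \<open>t\<close>, so
      \<open>s \<noteq> t\<close> makes \<open>arcs G\<close> a cut. This starts the search for a
      minimum.\<close>
    have "?R {} \<subseteq> {s}" "?T {} \<subseteq> {t}" by (rule reach_set_subsetI; simp)+
    then have "is_cut G s t (arcs G)"
      using that A by (auto simp: cut_iff Diff_eq_empty_iff[THEN iffD2])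
    then have "\<exists>M. is_min_cut G s t M"
      unfolding is_min_cut_def using ex_has_least_nat[of "is_cut G s t" "arcs G" card] by blast
    then obtain M where M: "is_min_cut G s t M"
      and small: "\<And>M'. is_min_cut G s t M' \<Longrightarrow> ?size M \<le> ?size M'"
      using ex_has_least_nat[of "is_min_cut G s t" _ ?size] by blast
    define P Q where "P = M \<inter> A1" and "Q = M \<inter> A2"
    have MC: "is_cut G s t M" and least: "\<And>M'. is_cut G s t M' \<Longrightarrow> card M \<le> card M'"
      using M by (auto simp: is_min_cut_def)
    have tie: "?size M \<le> ?size M'" if "is_cut G s t M'" "card M' = card M" for M'
      using that least by (intro small) (simp add: is_min_cut_def)
    have PQ: "P \<subseteq> A1" "Q \<subseteq> A2" "M = P \<union> Q" "A1 - M = A1 - P" "A2 - M = A2 - Q"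
      using MC A(1) by (auto simp: P_def Q_def cut_iff)
    have disj: "?R (A1 - P) \<inter> ?T (A2 - Q) = {}" using MC PQ by (simp add: cut_iff)
    \<comment> \<open>Since \<open>A1\<close> and \<open>A2\<close> are disjoint, the two parts of a
      cut can be varied independently, and cardinality and size split accordingly.\<close>
    have parts: "is_cut G s t (P' \<union> Q') \<longleftrightarrow> ?R (A1 - P') \<inter> ?T (A2 - Q') = {}"
      "card (P' \<union> Q') = card P' + card Q'"
      "?size (P' \<union> Q') = card (?R (A1 - P')) + card (?T (A2 - Q'))"
      if "P' \<subseteq> A1" "Q' \<subseteq> A2" for P' Q'
    proof -
      have eq: "A1 - (P' \<union> Q') = A1 - P'" "A2 - (P' \<union> Q') = A2 - Q'" using that A(2) by auto
      show "is_cut G s t (P' \<union> Q') \<longleftrightarrow> ?R (A1 - P') \<inter> ?T (A2 - Q') = {}"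
        unfolding cut_iff eq using that A(1) by auto
      show "card (P' \<union> Q') = card P' + card Q'"
        using that A(2) fin by (intro card_Un_disjoint) (auto intro: finite_subset)
      show "?size (P' \<union> Q') = card (?R (A1 - P')) + card (?T (A2 - Q'))"
        unfolding eq ..
    qed
    note PQ_parts = parts[OF PQ(1,2), folded PQ(3)]
    have finR: "finite (?R (A1 - X))" and finT: "finite (?T (A2 - X))" for X
      using fin by (auto intro: finite_reach_set)
    \<comment> \<open>\<open>Z\<close> is the set of vertices reaching \<open>t\<close> once
      \<open>Q\<close> is deleted. Finiteness turns the comparison of sizes into the ban on proper
      inclusion.\<close>
    have early: "\<exists>N\<subseteq>P. v \<notin> ?R (A1 - N) \<and>
        (\<forall>N'\<subseteq>A1. ?R (A1 - N') \<subset> ?R (A1 - N) \<longrightarrow> card N < card N')" if "v \<notin> ?R (A1 - P)" for v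
    proof (rule earliest_separator_within[OF fin(1) PQ(1) disj _ _ that])
      fix P' assume P': "P' \<subseteq> A1" "?R (A1 - P') \<inter> ?T (A2 - Q) = {}"
      then show "card P \<le> card P'"
        using least[of "P' \<union> Q"] parts[OF P'(1) PQ(2)] PQ_parts by simp
      assume "card P' = card P"
      then have "card (?R (A1 - P)) \<le> card (?R (A1 - P'))"
        using tie[of "P' \<union> Q"] P'(2) parts[OF P'(1) PQ(2)] PQ_parts by simp
      then show "\<not> ?R (A1 - P') \<subset> ?R (A1 - P)" using finR by (meson leD psubset_card_mono)
    qed
    have disj': "?T (A2 - Q) \<inter> ?R (A1 - P) = {}" using disj by blast
    have late: "\<exists>N\<subseteq>Q. v \<notin> ?T (A2 - N) \<and>
        (\<forall>N'\<subseteq>A2. ?T (A2 - N') \<subset> ?T (A2 - N) \<longrightarrow> card N < card N')" if "v \<notin> ?T (A2 - Q)" for v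
    proof (rule earliest_separator_within[OF fin(2) PQ(2) disj' _ _ that])
      fix Q' assume Q': "Q' \<subseteq> A2" "?T (A2 - Q') \<inter> ?R (A1 - P) = {}"
      then show "card Q \<le> card Q'"
        using least[of "P \<union> Q'"] parts[OF PQ(1) Q'(1)] PQ_parts by (simp add: Int_commute)
      assume "card Q' = card Q"
      then have "card (?T (A2 - Q)) \<le> card (?T (A2 - Q'))"
        using tie[of "P \<union> Q'"] Q'(2) parts[OF PQ(1) Q'(1)] PQ_parts by (simp add: Int_commute)
      then show "\<not> ?T (A2 - Q') \<subset> ?T (A2 - Q)" using finT by (meson leD psubset_card_mono)
    qed
    \<comment> \<open>The two reachable sets are disjoint, so \<open>v\<close> lies outside at least
      one of them, and that side supplies the required subset of \<open>M\<close>.\<close>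
    have "\<exists>N\<subseteq>M. earliest_cut (with_arcs G A1) s v N \<or> latest_cut (with_arcs G A2) v t N"
      if v: "v \<in> verts G" for v
    proof (cases "v \<in> ?R (A1 - P)")
      case False
      obtain N where N: "N \<subseteq> P" "v \<notin> ?R (A1 - N)"
        "\<forall>N'\<subseteq>A1. ?R (A1 - N') \<subset> ?R (A1 - N) \<longrightarrow> card N < card N'"
        using early[OF False] by (elim exE conjE) (rule that)
      have "earliest_cut (with_arcs G A1) s v N"
        unfolding earliest_cut_def strictly_earlier_def cut1_iff side1
        using N PQ(1) by (meson leD subset_trans)
      moreover have "N \<subseteq> M" using N(1) PQ(3) by blast
      ultimately show ?thesis by blast
    next
      case True
      then have *: "v \<notin> ?T (A2 - Q)" using disj by blast
      obtain N where N: "N \<subseteq> Q" "v \<notin> ?T (A2 - N)"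
        "\<forall>N'\<subseteq>A2. ?T (A2 - N') \<subset> ?T (A2 - N) \<longrightarrow> card N < card N'"
        using late[OF *] by (elim exE conjE) (rule that)
      have "latest_cut (with_arcs G A2) v t N"
        unfolding latest_cut_def strictly_later_def cut2_iff[OF v] side2
        using N PQ(2) by (meson leD subset_trans)
      moreover have "N \<subseteq> M" using N(1) PQ(3) by blast
      ultimately show ?thesis by blast
    qed
    then have "split_covering G A1 A2 s t M"
      unfolding split_covering_def using MC[unfolded cut_iff] by meson
    with M show ?thesis by blast
  qed
  with cut show ?thesis by blast
qed

end
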